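(* Let $\mathbf{k}=(k_1,\ldots,k_r)\in(\mathbb{Z}_{\ge1})^r$ be any index. For each prime $p$ let $\zeta_p$ be a primitive $p$-th root of unity and let $\mathfrak{p}_p=(1-\zeta_p)$ be the prime ideal of $\mathbb{Z}[\zeta_p]$ generated by $1-\zeta_p$. Then, identifying $\mathbb{Z}[\zeta_p]/\mathfrak{p}_p$ with $\mathbb{F}_p$, one has in $\mathcal{A}$ $$\big(z_p(\mathbf{k};\zeta_p)\bmod \mathfrak{p}_p\big)_p=\zeta_{\mathcal{A}}(\mathbf{k}),\qquad \big(z_p^\star(\mathbf{k};\zeta_p)\bmod \mathfrak{p}_p\big)_p=\zeta_{\mathcal{A}}^\star(\mathbf{k}).$$
   Context: For $n\ge1$, an index $\mathbf{k}=(k_1,\dots,k_r)$ of positive integers and $q\in\mathbb{C}$ with $q^m\ne1$ for $0<m<n$, set $[m]_q=\frac{1-q^m}{1-q}$ and $$z_n(\mathbf{k};q)=\sum_{n>m_1>\cdots>m_r>0}\prod_{j=1}^r\frac{q^{(k_j-1)m_j}}{[m_j]_q^{k_j}},\qquad z_n^\star(\mathbf{k};q)=\sum_{n>m_1\ge\cdots\ge m_r>0}\prod_{j=1}^r\frac{q^{(k_j-1)m_j}}{[m_j]_q^{k_j}}$$ (empty sums are $0$). For $n=p$ prime and $q=\zeta_p$ each $[m]_{\zeta_p}$ with $0<m<p$ is a unit of $\mathbb{Z}[\zeta_p]$, so these values lie in $\mathbb{Z}[\zeta_p]$. $\mathcal{A}=\big(\prod_{p}\mathbb{F}_p\big)/\big(\bigoplus_{p}\mathbb{F}_p\big)$,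 with $p$ running over all primes; elements are written $(a_p)_p$, and two are equal iff $a_p=b_p$ for all but finitely many $p$. The finite multiple zeta (star) values are $$\zeta_{\mathcal{A}}(\mathbf{k})=\Big(\sum_{p>m_1>\cdots>m_r>0}\frac{1}{m_1^{k_1}\cdots m_r^{k_r}}\bmod p\Big)_p,\qquad \zeta_{\mathcal{A}}^\star(\mathbf{k})=\Big(\sum_{p>m_1\ge\cdots\ge m_r>0}\frac{1}{m_1^{k_1}\cdots m_r^{k_r}}\bmod p\Big)_p.$$ *)

theory Defs
  imports
    "HOL-Algebra.Generated_Rings"
    "HOL-Algebra.QuotRing"
    "HOL-Algebra.Algebraic_Closure_Type"
    "HOL-Number_Theory.Residues"
    Complex_Main
begin

hide_const (open) Divisibility.prime

section \<open>Index sets and multiple harmonic q-sums\<close>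

text \<open>A tuple \<open>(m\<^sub>1, \<dots>, m\<^sub>r)\<close> is a list; the entry \<open>m\<^sub>j\<close> is \<open>ms ! (j - 1)\<close>.\<close>

definition strict_tuples :: "nat \<Rightarrow> nat \<Rightarrow> nat list set" where
  "strict_tuples n r = {ms. length ms = r \<and> set ms \<subseteq> {0<..<n} \<and> sorted_wrt (>) ms}"

definition weak_tuples :: "nat \<Rightarrow> nat \<Rightarrow> nat list set" where
  "weak_tuples n r = {ms. length ms = r \<and> set ms \<subseteq> {0<..<n} \<and> sorted_wrt (\<ge>) ms}"

definition q_int :: "complex \<Rightarrow> nat \<Rightarrow> complex" where
  "q_int q m = (1 - q ^ m) / (1 - q)"

definition z_val :: "nat \<Rightarrow> nat list \<Rightarrow> complex \<Rightarrow> complex" where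
  "z_val n ks q =
     (\<Sum>ms\<in>strict_tuples n (length ks). \<Prod>j<length ks.
        q ^ ((ks ! j - 1) * ms ! j) / q_int q (ms ! j) ^ (ks ! j))"

definition z_star_val :: "nat \<Rightarrow> nat list \<Rightarrow> complex \<Rightarrow> complex" where
  "z_star_val n ks q =
     (\<Sum>ms\<in>weak_tuples n (length ks). \<Prod>j<length ks.
        q ^ ((ks ! j - 1) * ms ! j) / q_int q (ms ! j) ^ (ks ! j))"

section \<open>The cyclotomic ring and its residue field at \<open>1 - \<zeta>\<close>\<close>

definition primitive_root_of_unity :: "nat \<Rightarrow> complex \<Rightarrow> bool" where
  "primitive_root_of_unity n z \<longleftrightarrow> 0 < n \<and> z ^ n = 1 \<and> (\<forall>m. 0 < m \<and> m < n \<longrightarrow> z ^ m \<noteq> 1)"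

text \<open>\<open>\<int>[\<zeta>]\<close>, as the subring of \<open>\<complex>\<close> generated by \<open>\<zeta>\<close>.\<close>

definition cyc_ring :: "complex \<Rightarrow> complex ring" where
  "cyc_ring z = ring_of_type_algebra\<lparr>carrier := generate_ring ring_of_type_algebra {z}\<rparr>"

definition cyc_ideal :: "complex \<Rightarrow> complex set" where
  "cyc_ideal z = PIdl\<^bsub>cyc_ring z\<^esub> (1 - z)"

definition Fp :: "nat \<Rightarrow> int ring" where
  "Fp p = residue_ring (int p)"

text \<open>
  The identification of \<open>\<int>[\<zeta>\<^sub>p] / (1 - \<zeta>\<^sub>p)\<close> with \<open>\<F>\<^sub>p\<close> is the inverse of the isomorphism
  \<open>\<F>\<^sub>p \<rightarrow> \<int>[\<zeta>\<^sub>p] / (1 - \<zeta>\<^sub>p)\<close> induced by \<open>\<int> \<rightarrow> \<int>[\<zeta>\<^sub>p]\<close>; it is the only ring isomorphism between the two.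
\<close>

definition Fp_to_quot :: "nat \<Rightarrow> complex \<Rightarrow> int \<Rightarrow> complex set" where
  "Fp_to_quot p z a = cyc_ideal z +>\<^bsub>cyc_ring z\<^esub> of_int a"

definition quot_to_Fp :: "nat \<Rightarrow> complex \<Rightarrow> complex set \<Rightarrow> int" where
  "quot_to_Fp p z = inv_into (carrier (Fp p)) (Fp_to_quot p z)"

definition reduce :: "nat \<Rightarrow> complex \<Rightarrow> complex \<Rightarrow> int" where
  "reduce p z x = quot_to_Fp p z (cyc_ideal z +>\<^bsub>cyc_ring z\<^esub> x)"

section \<open>The ring \<open>\<A>\<close>\<close>

definition product_ring :: "'i set \<Rightarrow> ('i \<Rightarrow> 'a ring) \<Rightarrow> ('i \<Rightarrow> 'a) ring" where
  "product_ring I R =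
     \<lparr>carrier = (\<Pi>\<^sub>E i\<in>I. carrier (R i)),
      monoid.mult = (\<lambda>x y. \<lambda>i\<in>I. x i \<otimes>\<^bsub>R i\<^esub> y i),
      one = (\<lambda>i\<in>I. \<one>\<^bsub>R i\<^esub>),
      ring.zero = (\<lambda>i\<in>I. \<zero>\<^bsub>R i\<^esub>),
      add = (\<lambda>x y. \<lambda>i\<in>I. x i \<oplus>\<^bsub>R i\<^esub> y i)\<rparr>"

definition direct_sum :: "'i set \<Rightarrow> ('i \<Rightarrow> 'a ring) \<Rightarrow> ('i \<Rightarrow> 'a) set" where
  "direct_sum I R =
     {x \<in> carrier (product_ring I R). finite {i \<in> I. x i \<noteq> \<zero>\<^bsub>R i\<^esub>}}"

abbreviation primes :: "nat set" where
  "primes \<equiv> {p. prime p}"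

definition ring_A :: "(nat \<Rightarrow> int) set ring" where
  "ring_A = product_ring primes Fp Quot direct_sum primes Fp"

text \<open>The element \<open>(a\<^sub>p)\<^sub>p\<close> of \<open>\<A>\<close>.\<close>

definition elem_A :: "(nat \<Rightarrow> int) \<Rightarrow> (nat \<Rightarrow> int) set" where
  "elem_A a = direct_sum primes Fp +>\<^bsub>product_ring primes Fp\<^esub> (\<lambda>p\<in>primes. a p)"

section \<open>Finite multiple zeta values\<close>

text \<open>
  The sums are evaluated in \<open>\<F>\<^sub>p\<close>. The entries satisfy \<open>0 < m\<^sub>j < p\<close>, so \<open>int m\<^sub>j\<close> is itself an
  element of \<^term>\<open>carrier (Fp p)\<close>.
\<close>

definition fmzv_term :: "nat \<Rightarrow> nat list \<Rightarrow> nat list \<Rightarrow> int" where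
  "fmzv_term p ks ms =
     inv\<^bsub>Fp p\<^esub> (\<Otimes>\<^bsub>Fp p\<^esub>j\<in>{..<length ks}. int (ms ! j) [^]\<^bsub>Fp p\<^esub> (ks ! j))"

definition zeta_A :: "nat list \<Rightarrow> (nat \<Rightarrow> int) set" where
  "zeta_A ks = elem_A (\<lambda>p. \<Oplus>\<^bsub>Fp p\<^esub>ms\<in>strict_tuples p (length ks). fmzv_term p ks ms)"

definition zeta_star_A :: "nat list \<Rightarrow> (nat \<Rightarrow> int) set" where
  "zeta_star_A ks = elem_A (\<lambda>p. \<Oplus>\<^bsub>Fp p\<^esub>ms\<in>weak_tuples p (length ks). fmzv_term p ks ms)"

section \<open>Well-definedness of \<open>\<A>\<close>\<close>

lemma cring_Fp: "prime p \<Longrightarrow> cring (Fp p)"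
  unfolding Fp_def using residues.cring[of "int p"] prime_gt_1_nat[of p]
  by (simp add: residues_def)

lemma product_ring_simps:
  "carrier (product_ring I R) = (\<Pi>\<^sub>E i\<in>I. carrier (R i))"
  "x \<otimes>\<^bsub>product_ring I R\<^esub> y = (\<lambda>i\<in>I. x i \<otimes>\<^bsub>R i\<^esub> y i)"
  "\<one>\<^bsub>product_ring I R\<^esub> = (\<lambda>i\<in>I. \<one>\<^bsub>R i\<^esub>)"
  "\<zero>\<^bsub>product_ring I R\<^esub> = (\<lambda>i\<in>I. \<zero>\<^bsub>R i\<^esub>)"
  "x \<oplus>\<^bsub>product_ring I R\<^esub> y = (\<lambda>i\<in>I. x i \<oplus>\<^bsub>R i\<^esub> y i)"
  by (simp_all add: product_ring_def)

lemma cring_product_ring: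
  assumes R: "\<And>i. i \<in> I \<Longrightarrow> cring (R i)"
  shows "cring (product_ring I R)"
proof (rule cringI)
  note r = cring.axioms(1)[OF R]
  note a = ring.is_abelian_group[OF r]
  note [simp] = product_ring_simps fun_eq_iff PiE_def Pi_def extensional_def
  show "abelian_group (product_ring I R)"
  proof (rule abelian_groupI)
    fix x assume x: "x \<in> carrier (product_ring I R)"
    show "\<exists>y\<in>carrier (product_ring I R). y \<oplus>\<^bsub>product_ring I R\<^esub> x = \<zero>\<^bsub>product_ring I R\<^esub>"
      by (rule bexI[of _ "\<lambda>i\<in>I. \<ominus>\<^bsub>R i\<^esub> x i"])
        (use x a in \<open>auto simp: abelian_group.l_neg abelian_group.a_inv_closed\<close>)
  qed (auto intro: ring.ring_simprules[OF r])
  show "comm_monoid (product_ring I R)"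
    by (rule comm_monoidI) (auto intro: cring.cring_simprules[OF R])
  show "(x \<oplus>\<^bsub>product_ring I R\<^esub> y) \<otimes>\<^bsub>product_ring I R\<^esub> z =
      x \<otimes>\<^bsub>product_ring I R\<^esub> z \<oplus>\<^bsub>product_ring I R\<^esub> y \<otimes>\<^bsub>product_ring I R\<^esub> z"
    if "x \<in> carrier (product_ring I R)" "y \<in> carrier (product_ring I R)"
      "z \<in> carrier (product_ring I R)" for x y z
    using that by (auto intro: cring.cring_simprules(13)[OF R])
qed

lemma ideal_direct_sum:
  assumes "\<And>i. i \<in> I \<Longrightarrow> cring (R i)"
  shows "ideal (direct_sum I R) (product_ring I R)"
proof -
  let ?P = "product_ring I R"
  note r = cring.axioms(1)[OF assms]
  have am: "abelian_monoid (R i)" if "i \<in> I" for i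
    using ring.is_abelian_group[OF r[OF that]] by (rule abelian_group.axioms(1))
  interpret P: cring ?P by (rule cring_product_ring[OF assms])
  show ?thesis
  proof (rule idealI)
    show "subgroup (direct_sum I R) (add_monoid ?P)"
    proof (rule P.add.subgroupI)
      show "direct_sum I R \<noteq> {}"
      proof -
        have z: "{i\<in>I. \<zero>\<^bsub>?P\<^esub> i \<noteq> \<zero>\<^bsub>R i\<^esub>} = {}" by (auto simp: product_ring_simps)
        have "\<zero>\<^bsub>?P\<^esub> \<in> direct_sum I R"
          unfolding direct_sum_def mem_Collect_eq z using P.zero_closed by blast
        then show ?thesis by blast
      qed
    next
      fix x y assume x: "x \<in> direct_sum I R" and y: "y \<in> direct_sum I R"
      have "{i\<in>I. (x \<oplus>\<^bsub>?P\<^esub> y) i \<noteq> \<zero>\<^bsub>R i\<^esub>} \<subseteq> {i\<in>I. x i \<noteq> \<zero>\<^bsub>R i\<^esub>} \<union> {i\<in>I. y i \<noteq> \<zero>\<^bsub>R i\<^esub>}"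
        by (auto simp: product_ring_simps abelian_monoid.l_zero abelian_monoid.zero_closed am)
      then show "x \<oplus>\<^bsub>?P\<^esub> y \<in> direct_sum I R"
        using x y by (auto simp: direct_sum_def intro: finite_subset)
    next
      fix x assume x: "x \<in> direct_sum I R"
      then have xc: "x \<in> carrier ?P" by (simp add: direct_sum_def)
      have "(\<ominus>\<^bsub>?P\<^esub> x) i = \<zero>\<^bsub>R i\<^esub>" if i: "i \<in> I" and 0: "x i = \<zero>\<^bsub>R i\<^esub>" for i
      proof -
        interpret R: cring "R i" by (rule assms[OF i])
        have n: "\<ominus>\<^bsub>?P\<^esub> x \<in> carrier ?P" using xc by simp
        have "(\<ominus>\<^bsub>?P\<^esub> x \<oplus>\<^bsub>?P\<^esub> x) i = \<zero>\<^bsub>?P\<^esub> i" using P.l_neg[OF xc] by simp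
        then show ?thesis using i 0 n by (auto simp: product_ring_simps PiE_def Pi_def)
      qed
      then have "{i\<in>I. (\<ominus>\<^bsub>?P\<^esub> x) i \<noteq> \<zero>\<^bsub>R i\<^esub>} \<subseteq> {i\<in>I. x i \<noteq> \<zero>\<^bsub>R i\<^esub>}" by auto
      then show "\<ominus>\<^bsub>?P\<^esub> x \<in> direct_sum I R"
        using x xc by (auto simp: direct_sum_def intro: finite_subset)
    qed (auto simp: direct_sum_def)
    fix a x assume a: "a \<in> direct_sum I R" and x: "x \<in> carrier ?P"
    then have ac: "a \<in> carrier ?P" by (simp add: direct_sum_def)
    have "{i\<in>I. (x \<otimes>\<^bsub>?P\<^esub> a) i \<noteq> \<zero>\<^bsub>R i\<^esub>} \<subseteq> {i\<in>I. a i \<noteq> \<zero>\<^bsub>R i\<^esub>}"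
      using x by (auto simp: product_ring_simps PiE_def Pi_def ring.ring_simprules(25)[OF r])
    then show xa: "x \<otimes>\<^bsub>?P\<^esub> a \<in> direct_sum I R"
      using a x ac by (auto simp: direct_sum_def intro: finite_subset)
    then show "a \<otimes>\<^bsub>?P\<^esub> x \<in> direct_sum I R"
      by (simp add: P.m_comm[OF ac x])
  qed (rule P.ring_axioms)
qed

lemma cring_ring_A: "cring ring_A"
  unfolding ring_A_def
  by (intro ideal.quotient_is_cring ideal_direct_sum cring_product_ring) (auto intro: cring_Fp)

lemma elem_A_closed:
  assumes "\<And>p. prime p \<Longrightarrow> a p \<in> carrier (Fp p)"
  shows "elem_A a \<in> carrier ring_A"
proof -
  interpret ideal "direct_sum primes Fp" "product_ring primes Fp"
    by (intro ideal_direct_sum) (auto intro: cring_Fp)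
  show ?thesis
    unfolding ring_A_def elem_A_def FactRing_def partial_object.simps
    by (rule a_rcosetsI[OF a_subset]) (use assms in \<open>auto simp: product_ring_simps\<close>)
qed

lemma elem_A_eq_iff:
  assumes "\<And>p. prime p \<Longrightarrow> a p \<in> carrier (Fp p)" and "\<And>p. prime p \<Longrightarrow> b p \<in> carrier (Fp p)"
  shows "elem_A a = elem_A b \<longleftrightarrow> finite {p. prime p \<and> a p \<noteq> b p}"
proof -
  let ?P = "product_ring primes Fp" and ?a = "\<lambda>p\<in>primes. a p" and ?b = "\<lambda>p\<in>primes. b p"
  interpret ideal "direct_sum primes Fp" ?P
    by (intro ideal_direct_sum) (auto intro: cring_Fp)
  have c: "?a \<in> carrier ?P" "?b \<in> carrier ?P"
    using assms by (auto simp: product_ring_simps)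
  have m: "(?a \<ominus>\<^bsub>?P\<^esub> ?b) p = \<zero>\<^bsub>Fp p\<^esub> \<longleftrightarrow> a p = b p" if p: "prime p" for p
  proof -
    interpret F: cring "Fp p" by (rule cring_Fp[OF p])
    have "?a = (?a \<ominus>\<^bsub>?P\<^esub> ?b) \<oplus>\<^bsub>?P\<^esub> ?b" 
      using c by (simp add: a_minus_def a_assoc l_neg)
    then have "?a p = ((?a \<ominus>\<^bsub>?P\<^esub> ?b) \<oplus>\<^bsub>?P\<^esub> ?b) p" by (rule arg_cong)
    moreover have "(?a \<ominus>\<^bsub>?P\<^esub> ?b) p \<in> carrier (Fp p)"
      using minus_closed[OF c] p by (auto simp: product_ring_simps PiE_def Pi_def)
    ultimately show ?thesis
      using p assms[OF p]
      by (auto simp: product_ring_simps F.add.l_cancel_one)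
  qed
  have "elem_A a = elem_A b \<longleftrightarrow> ?a \<ominus>\<^bsub>?P\<^esub> ?b \<in> direct_sum primes Fp"
    unfolding elem_A_def using quotient_eq_iff_same_a_r_cos[OF ideal_axioms c] by simp
  also have "\<dots> \<longleftrightarrow> finite {p. prime p \<and> a p \<noteq> b p}"
  proof -
    have "{p \<in> primes. (?a \<ominus>\<^bsub>?P\<^esub> ?b) p \<noteq> \<zero>\<^bsub>Fp p\<^esub>} = {p. prime p \<and> a p \<noteq> b p}"
      using m by blast
    then show ?thesis
      unfolding direct_sum_def using minus_closed[OF c] by simp
  qed
  finally show ?thesis .
qed

end

theory Submission
  imports Defs
begin

text \<open>
  The equality holds prime by prime, with no exceptions. Modulo \<open>1 - \<zeta>\<close> every power of \<open>\<zeta>\<close> is \<open>1\<close>,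
  so the numerators disappear and the \<open>q\<close>-integer \<open>[m] = 1 + \<zeta> + \<dots> + \<zeta>^(m-1)\<close> becomes \<open>m\<close>. If
  \<open>m m' \<equiv> 1 (mod p)\<close>, then \<open>1 / [m] = (1 - \<zeta>^(m m')) / (1 - \<zeta>^m)\<close> is the sum of \<open>\<zeta>^(m i)\<close> over
  \<open>i < m'\<close>; hence it lies in \<open>\<int>[\<zeta>]\<close> and becomes \<open>m'\<close>, the inverse of \<open>m\<close> in \<open>\<F>\<^sub>p\<close>
  (\<open>inverse_q_int_has_residue\<close>). Sums and products of residues then give the two
  multiple harmonic sums (\<open>reduce_sum_eq\<close>).

  The arithmetic content is that reduction is well defined, that is, that
  \<open>\<F>\<^sub>p \<rightarrow> \<int>[\<zeta>] / (1 - \<zeta>)\<close> is injective: an integer \<open>a\<close> divisible by \<open>1 - \<zeta>\<close> is divisible by \<open>p\<close>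
  (\<open>has_residue_0_imp_dvd\<close>). Raising \<open>a = (1 - \<zeta>) w\<close> to the power \<open>p\<close> shows that \<open>p\<close> divides
  \<open>a^p\<close> in \<open>\<int>[\<zeta>]\<close>, because \<open>(1 - \<zeta>)^p \<equiv> 1 + (- \<zeta>)^p \<equiv> 0\<close> modulo \<open>p\<close>. It remains to see that divisibility of an
  integer by \<open>p\<close> in \<open>\<int>[\<zeta>]\<close> is divisibility in \<open>\<int>\<close> (\<open>cyc_int_multiple_imp_dvd\<close>). As \<open>\<int>[\<zeta>]\<close> is
  generated by \<open>1, \<zeta>, \<dots>, \<zeta>^(p-1)\<close> as an abelian group, this follows from a form of Nakayama's
  lemma (\<open>integral_system_divisible_imp_zero\<close>), proved by elimination.
\<close>

section \<open>Integers divisible by a prime in a finitely generated ring\<close>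

text \<open>
  Modulo \<open>p\<close> the matrix of this homogeneous system is diagonal with invertible entries, so its
  determinant is not divisible by \<open>p\<close> and is in particular nonzero. The
  proof eliminates the last unknown, which leaves a system of the same shape. The coefficients
  \<open>c i\<close> may differ because elimination multiplies the rows by integers prime to \<open>p\<close>.
\<close>

lemma integral_system_divisible_imp_zero:
  fixes v :: "nat \<Rightarrow> complex" and c :: "nat \<Rightarrow> int" and B :: "nat \<Rightarrow> nat \<Rightarrow> int"
  assumes p: "prime (p :: int)"
    and "\<And>i. i < n \<Longrightarrow> \<not> p dvd c i"
    and "\<And>i. i < n \<Longrightarrow> of_int (c i) * v i = of_int p * (\<Sum>j<n. of_int (B i j) * v j)"
    and "i < n"
  shows "v i = 0"
  using assms(2-)
proof (induction n arbitrary: c B i)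
  case 0
  then show ?case by simp
next
  case (Suc n)
  (* d is the pivot: the coefficient of v n in the last equation, with p times the diagonal term
     moved to the left. *)
  define d where "d = c n - p * B n n"
  have d: "\<not> p dvd d"
  proof
    assume "p dvd d"
    then have "p dvd d + p * B n n" by simp
    with Suc.prems(1)[of n] show False by (simp add: d_def)
  qed
  have last: "of_int d * v n = of_int p * (\<Sum>j<n. of_int (B n j) * v j)"
    using Suc.prems(2)[of n] by (simp add: d_def algebra_simps)
  have vi: "v i = 0" if "i < n" for i
  proof (rule Suc.IH[of "\<lambda>i. d * c i" "\<lambda>i j. d * B i j + p * B i n * B n j"])
    show "\<not> p dvd d * c i" if "i < n" for i
      using that d Suc.prems(1)[of i] p by (simp add: prime_dvd_mult_iff)
    fix i assume i: "i < n"
    have "of_int (d * c i) * v i = of_int d * (of_int (c i) * v i)" by simp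
    also have "\<dots> = of_int p * (\<Sum>j<n. of_int d * of_int (B i j) * v j)
        + of_int p * of_int (B i n) * (of_int d * v n)"
      using Suc.prems(2)[of i] i by (simp add: algebra_simps sum_distrib_left)
    also have "\<dots> = of_int p * (\<Sum>j<n. of_int (d * B i j + p * B i n * B n j) * v j)"
      unfolding last by (simp add: algebra_simps sum_distrib_left sum.distrib)
    finally show "of_int (d * c i) * v i =
        of_int p * (\<Sum>j<n. of_int (d * B i j + p * B i n * B n j) * v j)" .
  qed (use that in simp)
  have "of_int d * v n = 0" unfolding last by (simp add: vi)
  moreover have "d \<noteq> 0" using d by auto
  ultimately have "v n = 0" by simp
  with vi Suc.prems(3) show ?case by (cases "i = n") auto
qed

section \<open>The ring of integer combinations of powers of \<open>\<zeta>\<close>\<close>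

abbreviation cyc :: "complex \<Rightarrow> complex set" where
  "cyc z \<equiv> carrier (cyc_ring z)"

lemma cyc_ring_simps:
  "cyc z = generate_ring ring_of_type_algebra {z}"
  "x \<otimes>\<^bsub>cyc_ring z\<^esub> y = x * y"
  "\<one>\<^bsub>cyc_ring z\<^esub> = 1"
  "\<zero>\<^bsub>cyc_ring z\<^esub> = 0"
  "x \<oplus>\<^bsub>cyc_ring z\<^esub> y = x + y"
  by (simp_all add: cyc_ring_def ring_of_type_algebra_def)

lemma a_inv_type_algebra: "\<ominus>\<^bsub>ring_of_type_algebra\<^esub> x = - (x :: 'a :: comm_ring_1)"
proof -
  interpret ring "ring_of_type_algebra :: 'a ring" by (rule ring_from_type_algebra)
  show ?thesis
    by (rule minus_equality) (simp_all add: ring_of_type_algebra_def)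
qed

lemma cring_cyc_ring: "cring (cyc_ring z)"
proof -
  interpret ring "ring_of_type_algebra :: complex ring" by (rule ring_from_type_algebra)
  have r: "ring (cyc_ring z)"
    unfolding cyc_ring_def by (rule generate_ring_is_ring) (simp add: ring_of_type_algebra_def)
  then show ?thesis
    by (intro cring.intro monoid.monoid_comm_monoidI ring.axioms(2)) (auto simp: cyc_ring_simps)
qed

lemma
  shows cyc_1: "1 \<in> cyc z"
    and cyc_gen: "z \<in> cyc z"
    and cyc_uminus: "x \<in> cyc z \<Longrightarrow> - x \<in> cyc z"
    and cyc_add: "x \<in> cyc z \<Longrightarrow> y \<in> cyc z \<Longrightarrow> x + y \<in> cyc z"
    and cyc_mult: "x \<in> cyc z \<Longrightarrow> y \<in> cyc z \<Longrightarrow> x * y \<in> cyc z"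
  using generate_ring.one[of "ring_of_type_algebra" "{z}"]
    generate_ring.incl[of z "{z}" ring_of_type_algebra]
    generate_ring.a_inv[of x "ring_of_type_algebra" "{z}"]
    generate_ring.eng_add[of x "ring_of_type_algebra" "{z}" y]
    generate_ring.eng_mult[of x "ring_of_type_algebra" "{z}" y]
  by (simp_all add: cyc_ring_simps(1) a_inv_type_algebra) (simp_all add: ring_of_type_algebra_def)

lemma cyc_0: "0 \<in> cyc z"
  using cyc_add[OF cyc_1 cyc_uminus[OF cyc_1], of z] by simp

lemma cyc_diff: "x \<in> cyc z \<Longrightarrow> y \<in> cyc z \<Longrightarrow> x - y \<in> cyc z"
  using cyc_add[of x z "- y"] cyc_uminus[of y z] by simp

lemma cyc_power: "x \<in> cyc z \<Longrightarrow> x ^ n \<in> cyc z"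
  by (induction n) (auto intro: cyc_1 cyc_mult)

lemma cyc_sum: "(\<And>i. i \<in> A \<Longrightarrow> f i \<in> cyc z) \<Longrightarrow> sum f A \<in> cyc z"
  by (induction A rule: infinite_finite_induct) (auto intro: cyc_0 cyc_add)

lemma cyc_of_nat: "of_nat n \<in> cyc z"
  by (induction n) (auto intro: cyc_0 cyc_1 cyc_add)

lemma cyc_of_int: "of_int a \<in> cyc z"
  by (cases a rule: int_diff_cases) (simp add: cyc_diff cyc_of_nat)

lemmas cyc_intros = cyc_0 cyc_1 cyc_gen cyc_uminus cyc_add cyc_mult cyc_diff cyc_power cyc_sum
  cyc_of_nat cyc_of_int

lemma cyc_induct [consumes 1, case_names one gen uminus add mult]:
  assumes "x \<in> cyc z"
    and "P 1" "P z"
    and "\<And>x. x \<in> cyc z \<Longrightarrow> P x \<Longrightarrow> P (- x)"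
    and "\<And>x y. x \<in> cyc z \<Longrightarrow> y \<in> cyc z \<Longrightarrow> P x \<Longrightarrow> P y \<Longrightarrow> P (x + y)"
    and "\<And>x y. x \<in> cyc z \<Longrightarrow> y \<in> cyc z \<Longrightarrow> P x \<Longrightarrow> P y \<Longrightarrow> P (x * y)"
  shows "P x"
  using assms(1) unfolding cyc_ring_simps(1)
proof (induction rule: generate_ring.induct)
  case one
  then show ?case using assms(2) by (simp add: ring_of_type_algebra_def)
next
  case (incl h)
  then show ?case using assms(3) by simp
next
  case (a_inv h)
  then show ?case using assms(4) by (simp add: a_inv_type_algebra cyc_ring_simps(1))
next
  case (eng_add x y)
  then have "P (x + y)" using assms(5) by (simp add: cyc_ring_simps(1))
  then show ?case by (simp add: ring_of_type_algebra_def)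
next
  case (eng_mult x y)
  then have "P (x * y)" using assms(6) by (simp add: cyc_ring_simps(1))
  then show ?case by (simp add: ring_of_type_algebra_def)
qed

text \<open>
  Multiplication by an element of \<open>\<int>[\<zeta>]\<close> maps the group generated by \<open>1, \<zeta>, \<dots>, \<zeta>^(n-1)\<close> to
  itself. In matrix form this passes to sums (matrix sums) and products (matrix products), and
  only the generator \<open>\<zeta>\<close> uses \<open>\<zeta>^n = 1\<close>: it acts as a cyclic shift.
\<close>

lemma cyc_matrix:
  assumes "x \<in> cyc z" and z: "z ^ n = 1" and n: "0 < n"
  shows "\<exists>A :: nat \<Rightarrow> nat \<Rightarrow> int. \<forall>i<n. x * z ^ i = (\<Sum>j<n. of_int (A i j) * z ^ j)"
  using assms(1)
proof (induction rule: cyc_induct)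
  case one
  have "1 * z ^ i = (\<Sum>j<n. of_int (if i = j then 1 else 0) * z ^ j)" if "i < n" for i
  proof -
    have "(\<Sum>j<n. of_int (if i = j then 1 else 0) * z ^ j) = (\<Sum>j<n. if i = j then z ^ j else 0)"
      by (rule sum.cong) auto
    then show ?thesis using that by simp
  qed
  then show ?case by (intro exI[of _ "\<lambda>i j. if i = j then 1 else 0"]) blast
next
  case gen
  have "z * z ^ i = (\<Sum>j<n. of_int (if Suc i mod n = j then 1 else 0) * z ^ j)" for i
  proof -
    have "z * z ^ i = z ^ (n * (Suc i div n) + Suc i mod n)"
      by (simp only: mult_div_mod_eq power_Suc)
    also have "\<dots> = z ^ (Suc i mod n)"
      by (simp only: power_add power_mult z power_one mult_1)
    finally have "z * z ^ i = z ^ (Suc i mod n)" .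
    moreover have "(\<Sum>j<n. of_int (if Suc i mod n = j then 1 else 0) * z ^ j)
        = (\<Sum>j<n. if Suc i mod n = j then z ^ j else 0)"
      by (rule sum.cong) auto
    ultimately show ?thesis using n by simp
  qed
  then show ?case by (intro exI[of _ "\<lambda>i j. if Suc i mod n = j then 1 else 0"]) blast
next
  case (uminus x)
  then obtain A :: "nat \<Rightarrow> nat \<Rightarrow> int"
    where "\<forall>i<n. x * z ^ i = (\<Sum>j<n. of_int (A i j) * z ^ j)" by blast
  then show ?case
    by (intro exI[of _ "\<lambda>i j. - A i j"]) (simp add: sum_negf)
next
  case (add x y)
  then obtain A B :: "nat \<Rightarrow> nat \<Rightarrow> int"
    where "\<forall>i<n. x * z ^ i = (\<Sum>j<n. of_int (A i j) * z ^ j)"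
      and "\<forall>i<n. y * z ^ i = (\<Sum>j<n. of_int (B i j) * z ^ j)" by blast
  then show ?case
    by (intro exI[of _ "\<lambda>i j. A i j + B i j"]) (simp add: algebra_simps sum.distrib)
next
  case (mult x y)
  then obtain A B :: "nat \<Rightarrow> nat \<Rightarrow> int"
    where A: "\<forall>i<n. x * z ^ i = (\<Sum>j<n. of_int (A i j) * z ^ j)"
      and B: "\<forall>i<n. y * z ^ i = (\<Sum>j<n. of_int (B i j) * z ^ j)" by blast
  have "x * y * z ^ i = (\<Sum>j<n. of_int (\<Sum>k<n. B i k * A k j) * z ^ j)" if "i < n" for i
  proof -
    have "x * y * z ^ i = (\<Sum>k<n. of_int (B i k) * (x * z ^ k))"
      using B that by (simp add: algebra_simps sum_distrib_left)
    also have "\<dots> = (\<Sum>k<n. \<Sum>j<n. of_int (B i k * A k j) * z ^ j)"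
      using A by (intro sum.cong) (auto simp: sum_distrib_left algebra_simps)
    also have "\<dots> = (\<Sum>j<n. \<Sum>k<n. of_int (B i k * A k j) * z ^ j)"
      by (rule sum.swap)
    finally show ?thesis by (simp add: sum_distrib_right)
  qed
  then show ?case by (intro exI[of _ "\<lambda>i j. \<Sum>k<n. B i k * A k j"]) blast
qed

text \<open>
  If \<open>a = p x\<close> and \<open>A\<close> is the matrix of multiplication by \<open>x\<close>, then \<open>a v = p A v\<close> for the vector \<open>v\<close>
  of powers of \<open>\<zeta>\<close>. Were \<open>a\<close> prime to \<open>p\<close>, the elimination lemma would force \<open>v = 0\<close>, although its
  first entry is \<open>1\<close>.
\<close>

lemma cyc_int_multiple_imp_dvd:
  assumes p: "prime (p :: nat)" and z: "z ^ n = 1" and n: "0 < n"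
    and x: "x \<in> cyc z" and a: "of_int a = of_nat p * x"
  shows "int p dvd a"
proof (rule ccontr)
  assume "\<not> int p dvd a"
  obtain A :: "nat \<Rightarrow> nat \<Rightarrow> int" where
    A: "\<forall>i<n. x * z ^ i = (\<Sum>j<n. of_int (A i j) * z ^ j)"
    using cyc_matrix[OF x z n] by blast
  have "z ^ 0 = 0"
  proof (rule integral_system_divisible_imp_zero[of "int p" n "\<lambda>_. a" "\<lambda>i. z ^ i" A])
    show "of_int a * z ^ i = of_int (int p) * (\<Sum>j<n. of_int (A i j) * z ^ j)" if "i < n" for i
      unfolding A[rule_format, OF that, symmetric] by (simp add: a)
  qed (use p n \<open>\<not> int p dvd a\<close> in simp_all)
  then show False by simp
qed

text \<open>
  The error term is kept explicit because the ring has characteristic \<open>0\<close>; it is in \<open>p \<int>[\<zeta>]\<close> since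
  \<open>p\<close> divides the inner binomial coefficients.
\<close>

lemma cyc_freshmans_dream:
  assumes p: "prime (p :: nat)" and x: "x \<in> cyc z" and y: "y \<in> cyc z"
  shows "\<exists>w\<in>cyc z. (x + y) ^ p = x ^ p + y ^ p + of_nat p * w"
proof -
  define w where "w = (\<Sum>k\<in>{0<..<p}. of_nat ((p choose k) div p) * x ^ k * y ^ (p - k))"
  have p0: "0 < p" using p by (rule prime_gt_0_nat)
  have split: "{..p} = insert 0 (insert p {0<..<p})" using p0 by auto
  have "(x + y) ^ p = (\<Sum>k\<le>p. of_nat (p choose k) * x ^ k * y ^ (p - k))"
    by (rule binomial_ring)
  also have "\<dots> = y ^ p + x ^ p
      + (\<Sum>k\<in>{0<..<p}. of_nat (p choose k) * x ^ k * y ^ (p - k))"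
    unfolding split using p0 by simp
  also have "(\<Sum>k\<in>{0<..<p}. of_nat (p choose k) * x ^ k * y ^ (p - k)) = of_nat p * w"
  proof -
    have "of_nat (p choose k) = (of_nat p :: complex) * of_nat ((p choose k) div p)"
      if "k \<in> {0<..<p}" for k
    proof -
      have "p dvd p choose k" using that p by (intro dvd_choose_prime) auto
      then have "p * ((p choose k) div p) = p choose k" by simp
      then show ?thesis by (metis of_nat_mult)
    qed
    then show ?thesis
      unfolding w_def sum_distrib_left by (intro sum.cong) (auto simp: mult.assoc)
  qed
  finally show ?thesis
    using x y by (intro bexI[of _ w]) (auto simp: w_def intro!: cyc_intros)
qed

section \<open>Residues modulo \<open>1 - \<zeta>\<close>\<close>

text \<open>
  Congruence of \<open>x\<close> to an integer modulo the ideal generated by \<open>1 - \<zeta>\<close>, with the membership of \<open>x\<close> in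
  \<open>\<int>[\<zeta>]\<close> built in. It can be computed with in \<open>\<complex>\<close>, without cosets.
\<close>

definition has_residue :: "complex \<Rightarrow> complex \<Rightarrow> int \<Rightarrow> bool" where
  "has_residue z x a \<longleftrightarrow> (\<exists>w\<in>cyc z. x = of_int a + (1 - z) * w)"

lemma has_residue_of_int: "has_residue z (of_int a) a"
  unfolding has_residue_def by (intro bexI[of _ 0]) (auto intro: cyc_intros)

lemma has_residue_1: "has_residue z 1 1"
  using has_residue_of_int[of z 1] by simp

lemma has_residue_gen: "has_residue z z 1"
  unfolding has_residue_def by (intro bexI[of _ "-1"]) (auto intro: cyc_intros)

lemma has_residue_add:
  assumes "has_residue z x a" "has_residue z y b"
  shows "has_residue z (x + y) (a + b)"
proof -
  obtain v w where vw: "v \<in> cyc z" "w \<in> cyc z"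
    and xy: "x = of_int a + (1 - z) * v" "y = of_int b + (1 - z) * w"
    using assms by (auto simp: has_residue_def)
  show ?thesis
    unfolding has_residue_def xy using vw
    by (intro bexI[of _ "v + w"]) (simp_all add: algebra_simps cyc_intros)
qed

lemma has_residue_mult:
  assumes "has_residue z x a" "has_residue z y b"
  shows "has_residue z (x * y) (a * b)"
proof -
  obtain v w where vw: "v \<in> cyc z" "w \<in> cyc z"
    and xy: "x = of_int a + (1 - z) * v" "y = of_int b + (1 - z) * w"
    using assms by (auto simp: has_residue_def)
  show ?thesis
    unfolding has_residue_def xy using vw
    by (intro bexI[of _ "of_int a * w + of_int b * v + (1 - z) * v * w"])
      (simp_all add: algebra_simps cyc_intros)
qed

lemma has_residue_power: "has_residue z x a \<Longrightarrow> has_residue z (x ^ n) (a ^ n)"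
  by (induction n) (auto intro: has_residue_1 has_residue_mult)

lemma has_residue_sum:
  "(\<And>i. i \<in> A \<Longrightarrow> has_residue z (f i) (g i)) \<Longrightarrow> has_residue z (sum f A) (sum g A)"
  using has_residue_of_int[of z 0]
  by (induction A rule: infinite_finite_induct) (auto intro: has_residue_add)

lemma has_residue_prod:
  "(\<And>i. i \<in> A \<Longrightarrow> has_residue z (f i) (g i)) \<Longrightarrow> has_residue z (prod f A) (prod g A)"
  by (induction A rule: infinite_finite_induct) (auto intro: has_residue_1 has_residue_mult)

lemma has_residue_gen_power: "has_residue z (z ^ n) 1"
  using has_residue_power[OF has_residue_gen, of z n] by simp

lemma has_residue_imp_cyc: "has_residue z x a \<Longrightarrow> x \<in> cyc z"
  by (auto simp: has_residue_def intro!: cyc_intros)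

lemma cyc_ideal_coset_eq_iff:
  assumes "x \<in> cyc z"
  shows "cyc_ideal z +>\<^bsub>cyc_ring z\<^esub> x = cyc_ideal z +>\<^bsub>cyc_ring z\<^esub> of_int a \<longleftrightarrow> has_residue z x a"
proof -
  interpret cring "cyc_ring z" by (rule cring_cyc_ring)
  have I: "ideal (cyc_ideal z) (cyc_ring z)"
    unfolding cyc_ideal_def by (rule cgenideal_ideal) (auto intro: cyc_intros)
  have m: "\<ominus>\<^bsub>cyc_ring z\<^esub> of_int a = - of_int a"
    by (rule minus_equality) (auto simp: cyc_ring_simps(2-) intro: cyc_intros)
  have "cyc_ideal z +>\<^bsub>cyc_ring z\<^esub> x = cyc_ideal z +>\<^bsub>cyc_ring z\<^esub> of_int a \<longleftrightarrow>
      x \<ominus>\<^bsub>cyc_ring z\<^esub> of_int a \<in> cyc_ideal z"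
    using quotient_eq_iff_same_a_r_cos[OF I assms cyc_of_int] by simp
  also have "x \<ominus>\<^bsub>cyc_ring z\<^esub> of_int a = x - of_int a"
    by (simp add: a_minus_def m cyc_ring_simps(2-))
  also have "x - of_int a \<in> cyc_ideal z \<longleftrightarrow> has_residue z x a"
    unfolding cyc_ideal_def cgenideal_def has_residue_def
    by (auto simp: cyc_ring_simps(2-) algebra_simps)
  finally show ?thesis .
qed

locale prime_root_of_unity =
  fixes p :: nat and z :: complex
  assumes p: "prime p" and z: "primitive_root_of_unity p z"
begin

lemma p_pos: "0 < p"
  using p by (rule prime_gt_0_nat)

lemma root_power: "z ^ p = 1"
  using z by (simp add: primitive_root_of_unity_def)

lemma root_power_neq_1: "0 < m \<Longrightarrow> m < p \<Longrightarrow> z ^ m \<noteq> 1"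
  using z by (auto simp: primitive_root_of_unity_def)

lemma root_neq_1: "z \<noteq> 1"
  using root_power_neq_1[of 1] prime_gt_1_nat[OF p] by simp

sublocale residues "int p" "Fp p"
proof unfold_locales
  show "1 < int p" using prime_gt_1_nat[OF p] by simp
  show "Fp p \<equiv> residue_ring (int p)" by (simp only: Fp_def)
qed

text \<open>
  The vanishing sum of all \<open>p\<close>-th roots of unity has \<open>p\<close> summands of residue \<open>1\<close>. So residues matter
  only modulo \<open>p\<close>.
\<close>

lemma has_residue_0_p: "has_residue z 0 (int p)"
proof -
  have "has_residue z (\<Sum>i<p. z ^ i) (\<Sum>i<p. 1)"
    by (rule has_residue_sum) (rule has_residue_gen_power)
  moreover have "(\<Sum>i<p. z ^ i) = 0"
    using root_neq_1 by (simp add: sum_gp_strict root_power)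
  ultimately show ?thesis by simp
qed

lemma has_residue_cong:
  assumes "has_residue z x a" "a mod int p = b mod int p"
  shows "has_residue z x b"
proof -
  obtain t where t: "b = a + int p * t"
    using assms(2) by (metis mod_eqE)
  have "has_residue z (x + 0 * of_int t) (a + int p * t)"
    by (intro has_residue_add has_residue_mult assms has_residue_0_p has_residue_of_int)
  then show ?thesis by (simp add: t)
qed

text \<open>
  Up to multiples of \<open>p\<close>, the power is \<open>1 + (- \<zeta>)^p = 1 + (-1)^p\<close>, which is \<open>0\<close> for odd \<open>p\<close> and \<open>2 = p\<close>
  otherwise.
\<close>

lemma one_minus_root_power_p: "\<exists>w\<in>cyc z. (1 - z) ^ p = of_nat p * w"
proof -
  obtain w where w: "w \<in> cyc z" "(1 + - z) ^ p = 1 ^ p + (- z) ^ p + of_nat p * w"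
    using cyc_freshmans_dream[OF p, of 1 z "- z"] by (auto intro: cyc_intros)
  show ?thesis
  proof (cases "p = 2")
    case True
    then show ?thesis
      using w root_power by (intro bexI[of _ "1 + w"]) (auto intro: cyc_intros)
  next
    case False
    then have "odd p" using p prime_odd_nat prime_ge_2_nat[OF p] by auto
    then show ?thesis
      using w root_power by (intro bexI[of _ w]) (auto simp: power_minus_odd)
  qed
qed

text \<open>
  The integer \<open>a\<close> is a multiple of \<open>1 - \<zeta>\<close>, whose \<open>p\<close>-th power is a multiple of \<open>p\<close>; hence \<open>p\<close>
  divides \<open>a^p\<close>, first in \<open>\<int>[\<zeta>]\<close> and then in \<open>\<int>\<close>.
\<close>

lemma has_residue_0_imp_dvd:
  assumes "has_residue z 0 a"
  shows "int p dvd a"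
proof -
  obtain u where u: "u \<in> cyc z" "0 = of_int a + (1 - z) * u"
    using assms unfolding has_residue_def by blast
  define w where "w = - u"
  have w: "w \<in> cyc z" "of_int a = (1 - z) * w"
    using u by (simp_all add: w_def cyc_uminus eq_neg_iff_add_eq_0)
  obtain v where v: "v \<in> cyc z" "(1 - z) ^ p = of_nat p * v"
    using one_minus_root_power_p by blast
  have "of_int (a ^ p) = of_nat p * (v * w ^ p)"
    unfolding of_int_power w(2) power_mult_distrib v(2) by (rule mult.assoc)
  moreover have "v * w ^ p \<in> cyc z"
    by (rule cyc_mult[OF v(1) cyc_power[OF w(1)]])
  ultimately have "int p dvd a ^ p"
    using cyc_int_multiple_imp_dvd[OF p root_power p_pos] by blast
  then show ?thesis
    by (rule prime_dvd_power[rotated]) (simp add: p)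
qed

text \<open>
  The reduction map is defined through an inverse of \<open>\<F>\<^sub>p \<rightarrow> \<int>[\<zeta>] / (1 - \<zeta>)\<close>, which returns the
  expected representative because that map is injective by the preceding lemma.
\<close>

lemma reduce_eq:
  assumes "has_residue z x a"
  shows "reduce p z x = a mod int p"
proof -
  have inj: "inj_on (Fp_to_quot p z) (carrier (Fp p))"
  proof (rule inj_onI)
    fix b c assume b: "b \<in> carrier (Fp p)" and c: "c \<in> carrier (Fp p)"
      and "Fp_to_quot p z b = Fp_to_quot p z c"
    then have "has_residue z (of_int b) c"
      using cyc_ideal_coset_eq_iff[of "of_int b" z c] by (simp add: Fp_to_quot_def cyc_of_int)
    then have "has_residue z (of_int b + of_int (- b)) (c + - b)"
      by (rule has_residue_add) (rule has_residue_of_int)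
    then have "int p dvd c - b"
      by (intro has_residue_0_imp_dvd) simp
    then have "c mod int p = b mod int p"
      by (rule mod_eq_dvd_iff[THEN iffD2])
    moreover have "c mod int p = c" "b mod int p = b"
      using b c by (simp_all add: res_carrier_eq)
    ultimately show "b = c" by simp
  qed
  have "has_residue z x (a mod int p)"
    by (rule has_residue_cong[OF assms]) simp
  then have "cyc_ideal z +>\<^bsub>cyc_ring z\<^esub> x = Fp_to_quot p z (a mod int p)"
    unfolding Fp_to_quot_def by (simp add: cyc_ideal_coset_eq_iff has_residue_imp_cyc)
  then show ?thesis
    unfolding reduce_def quot_to_Fp_def by (simp only: inv_into_f_f[OF inj mod_in_carrier])
qed

section \<open>Multiple harmonic sums\<close>

text \<open>
  Since \<open>\<zeta> = (\<zeta>^m)^m'\<close>, the inverse \<open>(1 - \<zeta>) / (1 - \<zeta>^m)\<close> is a geometric sum with \<open>m'\<close> summands in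
  powers of \<open>\<zeta>^m\<close>.
\<close>

lemma inverse_q_int_has_residue:
  assumes m: "0 < m" "m < p" and m': "[m * m' = 1] (mod p)"
  shows "has_residue z (inverse (q_int z m)) (int m')"
proof -
  have mod1: "m * m' mod p = 1"
    using m' prime_gt_1_nat[OF p] by (simp add: cong_def)
  have "z ^ (m * m') = z ^ (p * (m * m' div p) + m * m' mod p)"
    by (simp only: mult_div_mod_eq)
  also have "\<dots> = z"
    by (simp only: mod1 power_add power_mult[of z p] root_power power_one mult_1 power_one_right)
  finally have zm: "(z ^ m) ^ m' = z" by (simp add: power_mult)
  have "inverse (q_int z m) = (\<Sum>i<m'. (z ^ m) ^ i)"
    using root_power_neq_1[OF m] by (simp add: q_int_def sum_gp_strict zm)
  moreover have "has_residue z (\<Sum>i<m'. (z ^ m) ^ i) (\<Sum>i<m'. 1)"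
    by (rule has_residue_sum) (simp only: power_mult[symmetric] has_residue_gen_power)
  ultimately show ?thesis by simp
qed

text \<open>
  Both sides are compared with the product \<open>b\<close> of integers inverse to the \<open>m\<^sub>j\<close> modulo \<open>p\<close>. The second
  claim shows that the term on the \<open>\<F>\<^sub>p\<close> side is a reduced representative, so that the sum in \<open>\<F>\<^sub>p\<close> can
  be computed in \<open>\<int>\<close> first.
\<close>

lemma summand_residue:
  assumes len: "length ms = length ks" and ms: "set ms \<subseteq> {0<..<p}"
  shows "has_residue z (\<Prod>j<length ks. z ^ ((ks ! j - 1) * ms ! j) / q_int z (ms ! j) ^ (ks ! j))
    (fmzv_term p ks ms)"
    and "fmzv_term p ks ms \<in> carrier (Fp p)"
proof -
  have "\<exists>m'. [m * m' = 1] (mod p)" if "m \<in> {0<..<p}" for m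
    using that p by (metis cong_solve_coprime_nat coprime_commute greaterThanLessThan_iff nat_dvd_not_less
        One_nat_def prime_imp_coprime_nat)
  then obtain I where I: "\<And>m. m \<in> {0<..<p} \<Longrightarrow> [m * I m = 1] (mod p)"
    by metis
  have msj: "ms ! j \<in> {0<..<p}" if "j < length ks" for j
    using that ms len by (metis nth_mem subsetD)
  define a b where "a = (\<Prod>j<length ks. int (ms ! j) ^ (ks ! j))"
    and "b = (\<Prod>j<length ks. int (I (ms ! j)) ^ (ks ! j))"
  have "[a * b = (\<Prod>j<length ks. 1)] (mod int p)"
    unfolding a_def b_def prod.distrib[symmetric]
  proof (rule cong_prod)
    fix j assume "j \<in> {..<length ks}"
    then have "[int (ms ! j * I (ms ! j)) = int 1] (mod int p)"
      unfolding cong_int_iff by (intro I msj) simp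
    then show "[int (ms ! j) ^ (ks ! j) * int (I (ms ! j)) ^ (ks ! j) = 1] (mod int p)"
      using cong_pow[of "int (ms ! j * I (ms ! j))" 1 "int p" "ks ! j"]
      by (simp add: power_mult_distrib)
  qed
  then have ab: "(a mod int p) \<otimes>\<^bsub>Fp p\<^esub> (b mod int p) = \<one>\<^bsub>Fp p\<^esub>"
    using m_gt_one by (simp add: mult_cong res_one_eq cong_def)
  have pow: "int (ms ! j) [^]\<^bsub>Fp p\<^esub> (ks ! j) = int (ms ! j) ^ (ks ! j) mod int p"
    if "j < length ks" for j
    using pow_cong[of "int (ms ! j)" "ks ! j"] msj[OF that] by simp
  have "(\<Otimes>\<^bsub>Fp p\<^esub>j\<in>{..<length ks}. int (ms ! j) [^]\<^bsub>Fp p\<^esub> (ks ! j)) =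
      (\<Otimes>\<^bsub>Fp p\<^esub>j\<in>{..<length ks}. int (ms ! j) ^ (ks ! j) mod int p)"
    by (intro finprod_cong') (simp_all add: pow Pi_I)
  also have "\<dots> = a mod int p"
    unfolding a_def by (rule prod_cong) simp
  finally have "fmzv_term p ks ms = inv\<^bsub>Fp p\<^esub> (a mod int p)"
    by (simp add: fmzv_term_def)
  also have "\<dots> = b mod int p"
    using inv_unique'[of "a mod int p" "b mod int p"] ab m_comm[of "a mod int p" "b mod int p"]
    by (simp add: mod_in_carrier)
  finally have fmzv: "fmzv_term p ks ms = b mod int p" .
  have "has_residue z (\<Prod>j<length ks. z ^ ((ks ! j - 1) * ms ! j) / q_int z (ms ! j) ^ (ks ! j))
      (\<Prod>j<length ks. 1 * int (I (ms ! j)) ^ (ks ! j))"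
    unfolding divide_inverse power_inverse[symmetric]
    by (intro has_residue_prod has_residue_mult has_residue_power has_residue_gen_power
        inverse_q_int_has_residue I msj) (use msj in auto)
  then show "has_residue z (\<Prod>j<length ks. z ^ ((ks ! j - 1) * ms ! j) / q_int z (ms ! j) ^ (ks ! j))
      (fmzv_term p ks ms)"
    unfolding fmzv by (rule has_residue_cong) (simp add: b_def)
  show "fmzv_term p ks ms \<in> carrier (Fp p)"
    by (simp add: fmzv)
qed

text \<open>Stated for an arbitrary set of tuples in order to cover the strict and the weak sums at once.\<close>

lemma reduce_sum_eq:
  assumes T: "\<And>ms. ms \<in> T \<Longrightarrow> length ms = length ks \<and> set ms \<subseteq> {0<..<p}"
  shows "reduce p z (\<Sum>ms\<in>T. \<Prod>j<length ks.
      z ^ ((ks ! j - 1) * ms ! j) / q_int z (ms ! j) ^ (ks ! j)) =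
    (\<Oplus>\<^bsub>Fp p\<^esub>ms\<in>T. fmzv_term p ks ms)"
proof -
  have "T \<subseteq> {ms. set ms \<subseteq> {0<..<p} \<and> length ms = length ks}" using T by auto
  then have fin: "finite T"
    by (rule finite_subset) (simp add: finite_lists_length_eq)
  have carrier: "fmzv_term p ks ms \<in> carrier (Fp p)" if "ms \<in> T" for ms
    using T[OF that] by (intro summand_residue(2)) auto
  have "reduce p z (\<Sum>ms\<in>T. \<Prod>j<length ks.
      z ^ ((ks ! j - 1) * ms ! j) / q_int z (ms ! j) ^ (ks ! j)) =
    (\<Sum>ms\<in>T. fmzv_term p ks ms) mod int p"
    using T by (intro reduce_eq has_residue_sum summand_residue(1)) auto
  also have "\<dots> = (\<Oplus>\<^bsub>Fp p\<^esub>ms\<in>T. fmzv_term p ks ms mod int p)"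
    by (rule sum_cong[OF fin, symmetric])
  also have "\<dots> = (\<Oplus>\<^bsub>Fp p\<^esub>ms\<in>T. fmzv_term p ks ms)"
  proof (rule finsum_cong')
    show "fmzv_term p ks ms mod int p = fmzv_term p ks ms" if "ms \<in> T" for ms
      using carrier[OF that] by (simp add: res_carrier_eq)
  qed (use carrier in blast)+
  finally show ?thesis .
qed

end

theorem theorem1p1:
  fixes ks :: "nat list" and \<zeta> :: "nat \<Rightarrow> complex"
  assumes "\<forall>k\<in>set ks. 1 \<le> k"
    and "\<forall>p. prime p \<longrightarrow> primitive_root_of_unity p (\<zeta> p)"
  shows "elem_A (\<lambda>p. reduce p (\<zeta> p) (z_val p ks (\<zeta> p))) = zeta_A ks \<and>
         elem_A (\<lambda>p. reduce p (\<zeta> p) (z_star_val p ks (\<zeta> p))) = zeta_star_A ks"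
proof
  have "reduce p (\<zeta> p) (z_val p ks (\<zeta> p)) =
      (\<Oplus>\<^bsub>Fp p\<^esub>ms\<in>strict_tuples p (length ks). fmzv_term p ks ms)" (is ?strict)
    and "reduce p (\<zeta> p) (z_star_val p ks (\<zeta> p)) =
      (\<Oplus>\<^bsub>Fp p\<^esub>ms\<in>weak_tuples p (length ks). fmzv_term p ks ms)" (is ?weak) if "prime p" for p
  proof -
    interpret prime_root_of_unity p "\<zeta> p"
      using that assms(2) by unfold_locales auto
    show ?strict
      unfolding z_val_def by (rule reduce_sum_eq) (simp add: strict_tuples_def)
    show ?weak
      unfolding z_star_val_def by (rule reduce_sum_eq) (simp add: weak_tuples_def)
  qed
  then show "elem_A (\<lambda>p. reduce p (\<zeta> p) (z_val p ks (\<zeta> p))) = zeta_A ks"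
    and "elem_A (\<lambda>p. reduce p (\<zeta> p) (z_star_val p ks (\<zeta> p))) = zeta_star_A ks"
    unfolding zeta_A_def zeta_star_A_def elem_A_def by (simp_all cong: restrict_cong)
qed

end
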